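(* Let $X$ and $Y$ be Polish spaces, $\mu\in\mathcal{P}(X)$, $\nu\in\mathcal{P}(Y)$, and let $c\colon X\times Y\to\mathbb{R}_+$ be continuous with $T_c(\mu,\nu)<\infty$. Let $(X_i)_{i\in I}$ and $(Y_j)_{j\in J}$ be the connected components of $\mathrm{supp}\,\mu$ and $\mathrm{supp}\,\nu$, respectively, where the index sets $I$ and $J$ are assumed to be finite. Suppose that 1) $f^c$ is continuous on the support of $\nu$ for all Kantorovich potentials $f\in S_c(\mu,\nu)$; 2) $\mu$ and $\nu$ are non-degenerate, meaning $\mu\big(\bigcup_{i\in\tilde I}X_i\big)\neq\nu\big(\bigcup_{j\in\tilde J}Y_j\big)$ for all proper non-empty subsets $\tilde I\subset I$ and $\tilde J\subset J$; 3) there is an optimal transport plan $\pi\in\mathcal{C}(\mu,\nu)$ such that for every $i\in I$ the Kantorovich potentials for the optimal transport problem between $\mu_i=\mu|_{X_i}/\mu(X_i)$ and $\nu_i=\pi(X_i\times\cdot)/\mu(X_i)$ (with cost function $c|_{X_i\times Y}$) are unique. Then the Kantorovich potentials between $\mu$ and $\nu$ (with cost $c$) are unique.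
   Context: $\mathcal{P}(X)$ is the set of Borel probability measures on $X$; $\mathcal{C}(\mu,\nu)$ is the set of probability measures on $X\times Y$ with marginals $\mu,\nu$ (transport plans); $T_c(\mu,\nu)=\inf_{\pi\in\mathcal{C}(\mu,\nu)}\int c\,\mathrm{d}\pi$, and $\pi$ is optimal if it attains this infimum. The support of a probability measure is the smallest closed set of full measure. $c$-transforms: for $g\colon Y\to\mathbb{R}\cup\{-\infty\}$ set $g^c(x)=\inf_{y\in Y}c(x,y)-g(y)$, and for $f\colon X\to\mathbb{R}\cup\{-\infty\}$ set $f^c(y)=\inf_{x\in X}c(x,y)-f(x)$; these are functions with values in $\mathbb{R}\cup\{-\infty\}$. A function $f\colon X\to\mathbb{R}\cup\{-\infty\}$ is $c$-concave on $X$ if $f=g^c$ for some $g\colon Y\to\mathbb{R}\cup\{-\infty\}$ and $f$ is not identically $-\infty$. A (generalized) Kantorovich potential between $\mu$ and $\nu$ is a $c$-concave function $f$ on $X$ such that $T_c(\mu,\nu)=\int c\,\mathrm{d}\pi=\int\big(f(x)+f^c(y)\big)\,\mathrm{d}\pi(x,y)$ for an optimal plan $\pi$ (equivalently, for every optimal plan). The set of these is denoted $S_c(\mu,\nu)$; the functions $f$ and $f^c$ need not be integrable individually. The same definitions apply with $X$ replaced by $X_i$ and $c$ by $c|_{X_i\times Y}$. Kantorovich potentials are called unique if $f_1-f_2$ is $\mu$-almost surely constant for all $f_1,f_2\in S_c(\mu,\nu)$ (with $\mu$ replaced by $\mu_i$ for the problem between $\mu_i$ and $\nu_i$).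
   Formalization: Condition 1) is taken to mean that f^c is finite-valued as well as continuous on the support of ν; if f^c could be continuous with the value −∞ at points of supp ν, the claim would be false. *)

theory Defs
  imports "HOL-Probability.Probability"
begin

text \<open>
  Spaces are the carriers \<open>space M\<close> of measures, so that the definitions apply verbatim to
  problems on a Borel subset of a Polish space (with the trace sigma-algebra). Functions with
  values in \<open>\<real> \<union> {-\<infinity>}\<close> are \<open>ereal\<close>-valued functions that avoid \<open>\<infinity>\<close> on the carrier; their values
  off the carrier are irrelevant.
\<close>

text \<open>In a second countable space this set again has full measure (\<open>support_full\<close> below), so it is
  the smallest closed set of full measure.\<close>

definition support :: "'a::topological_space measure \<Rightarrow> 'a set" where
  "support M = \<Inter>{C. closed C \<and> emeasure M C = emeasure M (space M)}"

text \<open>For Borel measures on second countable spaces, the product sigma-algebra is the Borel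
  sigma-algebra of the product space.\<close>

definition transport_plans :: "'a measure \<Rightarrow> 'b measure \<Rightarrow> ('a \<times> 'b) measure set" where
  "transport_plans M N =
     {P. prob_space P \<and> sets P = sets (M \<Otimes>\<^sub>M N) \<and> distr P M fst = M \<and> distr P N snd = N}"

definition transport_cost :: "('a \<times> 'b \<Rightarrow> real) \<Rightarrow> 'a measure \<Rightarrow> 'b measure \<Rightarrow> ennreal" where
  "transport_cost c M N = (INF P \<in> transport_plans M N. \<integral>\<^sup>+ z. ennreal (c z) \<partial>P)"

definition optimal_plan ::
    "('a \<times> 'b \<Rightarrow> real) \<Rightarrow> 'a measure \<Rightarrow> 'b measure \<Rightarrow> ('a \<times> 'b) measure \<Rightarrow> bool" where
  "optimal_plan c M N P \<longleftrightarrow>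
     P \<in> transport_plans M N \<and> (\<integral>\<^sup>+ z. ennreal (c z) \<partial>P) = transport_cost c M N"

definition ctransform_Y :: "'b set \<Rightarrow> ('a \<times> 'b \<Rightarrow> real) \<Rightarrow> ('b \<Rightarrow> ereal) \<Rightarrow> 'a \<Rightarrow> ereal" where
  "ctransform_Y Y c g x = (INF y\<in>Y. ereal (c (x, y)) - g y)"

definition ctransform_X :: "'a set \<Rightarrow> ('a \<times> 'b \<Rightarrow> real) \<Rightarrow> ('a \<Rightarrow> ereal) \<Rightarrow> 'b \<Rightarrow> ereal" where
  "ctransform_X X c f y = (INF x\<in>X. ereal (c (x, y)) - f x)"

text \<open>The requirement \<open>f x \<noteq> \<infinity>\<close> excludes \<open>g = -\<infinity>\<close>, whose transform is not
  \<open>\<real> \<union> {-\<infinity>}\<close>-valued.\<close>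

definition c_concave :: "'a set \<Rightarrow> 'b set \<Rightarrow> ('a \<times> 'b \<Rightarrow> real) \<Rightarrow> ('a \<Rightarrow> ereal) \<Rightarrow> bool" where
  "c_concave X Y c f \<longleftrightarrow>
     (\<forall>x\<in>X. f x \<noteq> \<infinity>) \<and> (\<exists>x\<in>X. f x \<noteq> -\<infinity>) \<and>
     (\<exists>g. (\<forall>y\<in>Y. g y \<noteq> \<infinity>) \<and> (\<forall>x\<in>X. f x = ctransform_Y Y c g x))"

text \<open>Integral of an extended real valued function whose positive part has finite integral
  (otherwise, \<open>\<infinity> - \<infinity> = \<infinity>\<close> makes it \<open>\<infinity>\<close>). Below it is applied to \<open>f x + f\<^sup>c y \<le> c (x, y)\<close> under
  plans of finite cost.\<close>

definition ereal_integral :: "'a measure \<Rightarrow> ('a \<Rightarrow> ereal) \<Rightarrow> ereal" where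
  "ereal_integral M h =
     enn2ereal (\<integral>\<^sup>+ x. e2ennreal (h x) \<partial>M) - enn2ereal (\<integral>\<^sup>+ x. e2ennreal (- h x) \<partial>M)"

definition kantorovich_potentials ::
    "('a \<times> 'b \<Rightarrow> real) \<Rightarrow> 'a measure \<Rightarrow> 'b measure \<Rightarrow> ('a \<Rightarrow> ereal) set" where
  "kantorovich_potentials c M N =
     {f. c_concave (space M) (space N) c f \<and>
         (\<exists>P. optimal_plan c M N P \<and>
            enn2ereal (transport_cost c M N) =
            ereal_integral P (\<lambda>(x, y). f x + ctransform_X (space M) c f y))}"

definition unique_kantorovich_potentials ::
    "('a \<times> 'b \<Rightarrow> real) \<Rightarrow> 'a measure \<Rightarrow> 'b measure \<Rightarrow> bool" where
  "unique_kantorovich_potentials c M N \<longleftrightarrow>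
     (\<forall>f1 \<in> kantorovich_potentials c M N. \<forall>f2 \<in> kantorovich_potentials c M N.
        \<exists>a::real. AE x in M. f1 x - f2 x = ereal a)"

definition source_piece :: "'a measure \<Rightarrow> 'a set \<Rightarrow> 'a measure" where
  "source_piece M A = scale_measure (1 / emeasure M A) (restrict_space M A)"

definition target_piece ::
    "'a measure \<Rightarrow> 'b measure \<Rightarrow> ('a \<times> 'b) measure \<Rightarrow> 'a set \<Rightarrow> 'b measure" where
  "target_piece M N P A =
     scale_measure (1 / emeasure M A) (distr (restrict_space P (A \<times> space N)) N snd)"

definition nondegenerate ::
    "'a::topological_space measure \<Rightarrow> 'b::topological_space measure \<Rightarrow> bool" where
  "nondegenerate M N \<longleftrightarrow>
     (\<forall>\<A> \<B>. \<A> \<noteq> {} \<and> \<A> \<subset> components (support M) \<and> \<B> \<noteq> {} \<and> \<B> \<subset> components (support N) \<longrightarrow>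
        emeasure M (\<Union>\<A>) \<noteq> emeasure N (\<Union>\<B>))"

lemma closed_support: "closed (support M)"
  unfolding support_def by auto

lemma support_full:
  fixes M :: "'a::second_countable_topology measure"
  assumes "sets M = sets borel" "finite_measure M"
  shows "emeasure M (support M) = emeasure M (space M)"
proof -
  interpret finite_measure M by fact
  define G where "G = {S. open S \<and> S \<in> null_sets M}"
  have sp: "space M = UNIV" using sets_eq_imp_space_eq[OF assms(1)] by simp
  have co: "- S \<in> G \<longleftrightarrow> closed S \<and> emeasure M S = emeasure M (space M)" for S
  proof (cases "closed S")
    case True
    then have S: "S \<in> sets M" using assms(1) by simp
    have cS: "- S \<in> sets M" using True assms(1) by (simp add: open_Compl)
    have "emeasure M S + emeasure M (- S) = emeasure M (space M)"
      using plus_emeasure[OF S cS] sp by simp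
    moreover note cS
    moreover have "emeasure M S \<noteq> \<infinity>" using emeasure_finite by simp
    ultimately show ?thesis
      using True ennreal_add_left_cancel[of "emeasure M S" "emeasure M (- S)" 0]
      by (auto simp: G_def null_sets_def open_Compl)
  qed (simp add: G_def closed_def)
  obtain F where F: "F \<subseteq> G" "countable F" "\<Union>F = \<Union>G"
    by (rule Lindelof[of G]) (simp_all add: G_def)
  have "(\<Union>S\<in>F. S) \<in> null_sets M"
    by (rule null_sets_UN'[OF F(2)]) (use F(1) in \<open>auto simp: G_def\<close>)
  then have null: "\<Union>F \<in> null_sets M" by (simp only: image_ident)
  have "support M = \<Inter>{S. - S \<in> G}"
    unfolding support_def co ..
  also have "\<dots> = space M - \<Union>G"
  proof (intro equalityI subsetI)
    fix x assume x: "x \<in> \<Inter>{S. - S \<in> G}"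
    have "x \<notin> U" if "U \<in> G" for U
    proof -
      have "- (- U) \<in> G" using that by simp
      with x have "x \<in> - U" by blast
      then show ?thesis by simp
    qed
    then show "x \<in> space M - \<Union>G" using sp by simp
  qed blast
  finally have "emeasure M (support M) = emeasure M (space M - \<Union>F)"
    by (simp only: F(3))
  also have "\<dots> = emeasure M (space M)"
    by (rule emeasure_Diff_null_set[OF null sets.top])
  finally show ?thesis .
qed

lemma emeasure_source_piece:
  assumes "A \<in> sets M" "B \<in> sets M" "B \<subseteq> A"
  shows "emeasure (source_piece M A) B = emeasure M B / emeasure M A"
proof -
  have "A \<inter> space M \<in> sets M" using assms(1) by auto
  then have "emeasure (restrict_space M A) B = emeasure M B"
    using assms(3) by (rule emeasure_restrict_space)
  then show ?thesis
    unfolding source_piece_def emeasure_scale_measure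
    by (simp only: divide_ennreal_def mult_1_left mult.commute)
qed

lemma emeasure_target_piece:
  assumes "sets P = sets (M \<Otimes>\<^sub>M N)" "A \<in> sets M" "B \<in> sets N"
  shows "emeasure (target_piece M N P A) B = emeasure P (A \<times> B) / emeasure M A"
proof -
  have spP: "space P = space M \<times> space N"
    using sets_eq_imp_space_eq[OF assms(1)] by (simp add: space_pair_measure)
  have AM: "A \<subseteq> space M" and BN: "B \<subseteq> space N"
    using assms sets.sets_into_space by blast+
  have A: "(A \<times> space N) \<inter> space P \<in> sets P"
    unfolding assms(1) spP using assms(2) by auto
  have "snd \<in> P \<rightarrow>\<^sub>M N" using measurable_cong_sets[OF assms(1) refl] by auto
  then have m: "snd \<in> restrict_space P (A \<times> space N) \<rightarrow>\<^sub>M N" by (rule measurable_restrict_space1)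
  have eq: "snd -` B \<inter> space (restrict_space P (A \<times> space N)) = A \<times> B"
    using AM BN by (auto simp: space_restrict_space spP)
  have "A \<times> B \<subseteq> A \<times> space N" using BN by auto
  from emeasure_restrict_space[OF A this] show ?thesis
    unfolding target_piece_def emeasure_scale_measure emeasure_distr[OF m assms(3)] eq
    by (simp only: divide_ennreal_def mult_1_left mult.commute)
qed

end

theory Submission
  imports Defs
begin

text \<open>
  Let \<open>f\<^sub>1, f\<^sub>2\<close> be potentials. Each restriction of \<open>f\<^sub>k\<close> to a component \<open>X\<^sub>i\<close> is a potential of the
  \<open>i\<close>-th piece, so \<open>f\<^sub>1 - f\<^sub>2\<close> equals a constant \<open>a\<^sub>i\<close> almost surely on \<open>X\<^sub>i\<close>. Since
  \<open>f\<^sub>k x + f\<^sub>k\<^sup>c y = c (x, y)\<close> for \<open>\<pi>\<close>-almost all \<open>(x, y)\<close>, the function \<open>h = f\<^sub>2\<^sup>c - f\<^sub>1\<^sup>c\<close> takes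
  \<open>\<nu>\<close>-almost surely one of the finitely many values \<open>a\<^sub>i\<close>; being continuous on \<open>supp \<nu>\<close>, it does so
  everywhere there and is constant on every \<open>Y\<^sub>j\<close>. Hence \<open>\<pi>\<close> couples the union of the \<open>X\<^sub>i\<close> with
  \<open>a\<^sub>i = a\<close> exactly to the union of the \<open>Y\<^sub>j\<close> with \<open>h = a\<close>, and these have equal mass.
  Nondegeneracy leaves only one value \<open>a\<close>.
\<close>

section \<open>Marginals of transport plans\<close>

lemma transport_plansD:
  assumes "P \<in> transport_plans M N"
  shows "prob_space P" "sets P = sets (M \<Otimes>\<^sub>M N)" "distr P M fst = M" "distr P N snd = N"
  using assms by (auto simp: transport_plans_def)

lemma space_transport_plan:
  assumes "P \<in> transport_plans M N"
  shows "space P = space M \<times> space N"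
  using sets_eq_imp_space_eq[OF transport_plansD(2)[OF assms]] by (simp add: space_pair_measure)

lemma AE_transport_plan_fst:
  assumes P: "P \<in> transport_plans M N" and "AE x in M. Q x"
  shows "AE z in P. Q (fst z)"
proof -
  note transport_plansD(2)[OF P, measurable_cong]
  have "fst \<in> P \<rightarrow>\<^sub>M M" by measurable
  moreover have "AE x in distr P M fst. Q x" by (simp only: assms(2) transport_plansD(3)[OF P])
  ultimately show ?thesis by (rule AE_distrD)
qed

lemma AE_transport_plan_snd:
  assumes P: "P \<in> transport_plans M N" and "AE y in N. Q y"
  shows "AE z in P. Q (snd z)"
proof -
  note transport_plansD(2)[OF P, measurable_cong]
  have "snd \<in> P \<rightarrow>\<^sub>M N" by measurable
  moreover have "AE x in distr P N snd. Q x" by (simp only: assms(2) transport_plansD(4)[OF P])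
  ultimately show ?thesis by (rule AE_distrD)
qed

section \<open>Duality gap and complementary slackness\<close>

text \<open>
  The integrals of \<open>u\<close> and \<open>v\<close> need not exist, so \<open>u\<close> and \<open>v\<close> are truncated at \<open>\<plusminus>n\<close>: the truncated
  sum \<open>w n\<close> has the same integral under all plans and stays below \<open>c\<close>, so that dominated
  convergence applies under \<open>P\<close> and Fatou's lemma applies to \<open>c - w n\<close> under \<open>P'\<close>.
\<close>

lemma slackness_excess:
  fixes u :: "'a \<Rightarrow> real" and v :: "'b \<Rightarrow> real" and c :: "'a \<times> 'b \<Rightarrow> real"
  assumes P: "P \<in> transport_plans M N" and P': "P' \<in> transport_plans M N"
    and u: "u \<in> borel_measurable M" and v: "v \<in> borel_measurable N"
    and c: "integrable P c" and c': "integrable P' c" and nonneg: "\<And>z. 0 \<le> c z"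
    and eq: "AE z in P. u (fst z) + v (snd z) = c z"
    and le: "AE z in P'. u (fst z) + v (snd z) \<le> c z"
  shows "(\<integral>\<^sup>+ z. ennreal (c z - (u (fst z) + v (snd z))) \<partial>P')
      \<le> ennreal ((\<integral>z. c z \<partial>P') - (\<integral>z. c z \<partial>P))" (is "?E \<le> _")
    and "(\<integral>z. c z \<partial>P) \<le> (\<integral>z. c z \<partial>P')"
proof -
  define T where "T n t = max (- real n) (min (real n) t)" for n t
  define w where "w n z = T n (u (fst z)) + T n (v (snd z))" for n z
  have T_lim: "(\<lambda>n. T n t) \<longlonglongrightarrow> t" for t
  proof (rule tendsto_eventually)
    obtain m where "\<bar>t\<bar> \<le> real m" using real_arch_simple by blast
    then have "T n t = t" if "n \<ge> m" for n
      using that by (auto simp: T_def max_def min_def)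
    then show "\<forall>\<^sub>F n in sequentially. T n t = t"
      unfolding eventually_sequentially by blast
  qed
  have w_lim: "(\<lambda>n. w n z) \<longlonglongrightarrow> u (fst z) + v (snd z)" for z
    unfolding w_def by (intro tendsto_add T_lim)
  \<comment> \<open>If \<open>a\<close> or \<open>b\<close> lies below \<open>- n\<close>, the
    truncated sum is at most \<open>- n + n = 0 \<le> C\<close>; otherwise truncation only lowers
    both terms. For \<open>T_ge\<close>, \<open>T n\<close> is odd and monotone, so
    \<open>a \<ge> - b\<close> survives truncation. Under \<open>P\<close>, where the sum is
    \<open>c \<ge> 0\<close>, the two bounds together make \<open>c\<close> a dominating
    function.\<close>
  have T_le: "T n a + T n b \<le> C" if "a + b \<le> C" "0 \<le> C" for n a b C
    using that by (auto simp: T_def max_def min_def)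
  have T_ge: "0 \<le> T n a + T n b" if "0 \<le> a + b" for n a b
    using that by (auto simp: T_def max_def min_def)
  have T_meas [measurable]: "T n \<in> borel_measurable borel" for n
    unfolding T_def by measurable
  note u [measurable] v [measurable]
  have T_int: "integrable Q (\<lambda>z. T n (u (fst z)))" "integrable Q (\<lambda>z. T n (v (snd z)))"
    "(\<integral>z. w n z \<partial>Q) = (\<integral>x. T n (u x) \<partial>M) + (\<integral>y. T n (v y) \<partial>N)"
    "w n \<in> borel_measurable Q"
    if Q: "Q \<in> transport_plans M N" for Q n
  proof -
    interpret prob_space Q using transport_plansD(1)[OF Q] .
    note transport_plansD(2)[OF Q, measurable_cong]
    show 1: "integrable Q (\<lambda>z. T n (u (fst z)))"
      by (rule integrable_const_bound[where B="real n"]) (auto simp: T_def)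
    show 2: "integrable Q (\<lambda>z. T n (v (snd z)))"
      by (rule integrable_const_bound[where B="real n"]) (auto simp: T_def)
    have "(\<integral>z. T n (u (fst z)) \<partial>Q) = (\<integral>x. T n (u x) \<partial>distr Q M fst)"
      by (rule integral_distr[symmetric]) measurable
    moreover have "(\<integral>z. T n (v (snd z)) \<partial>Q) = (\<integral>x. T n (v x) \<partial>distr Q N snd)"
      by (rule integral_distr[symmetric]) measurable
    ultimately show "(\<integral>z. w n z \<partial>Q) = (\<integral>x. T n (u x) \<partial>M) + (\<integral>y. T n (v y) \<partial>N)"
      unfolding w_def using 1 2 transport_plansD(3,4)[OF Q] by simp
    show "w n \<in> borel_measurable Q" unfolding w_def by measurable
  qed
  have w_int: "integrable Q (w n)" if "Q \<in> transport_plans M N" for Q n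
    unfolding w_def using T_int[OF that] by simp
  have same: "(\<integral>z. w n z \<partial>P') = (\<integral>z. w n z \<partial>P)" for n
    using T_int(3)[OF P] T_int(3)[OF P'] by simp
  have lim: "(\<lambda>n. \<integral>z. w n z \<partial>P) \<longlonglongrightarrow> (\<integral>z. c z \<partial>P)"
  proof (rule integral_dominated_convergence[where w=c])
    show "c \<in> borel_measurable P" using c by simp
    show "AE z in P. (\<lambda>n. w n z) \<longlonglongrightarrow> c z" using eq w_lim by (auto elim!: eventually_mono) metis
    show "AE z in P. norm (w n z) \<le> c z" for n
      using eq
    proof eventually_elim
      case (elim z)
      then show ?case
        unfolding w_def using T_le[of "u (fst z)" "v (snd z)" "c z" n] nonneg[of z]
          T_ge[of "u (fst z)" "v (snd z)" n] by simp
    qed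
  qed (use c T_int(4)[OF P] in auto)
  have w_le: "AE z in P'. w n z \<le> c z" for n
    using le by eventually_elim (use nonneg in \<open>auto simp: w_def intro!: T_le\<close>)
  have "(\<integral>z. w n z \<partial>P) \<le> (\<integral>z. c z \<partial>P')" for n
    unfolding same[symmetric] by (rule integral_mono_AE[OF w_int[OF P'] c' w_le])
  then show "(\<integral>z. c z \<partial>P) \<le> (\<integral>z. c z \<partial>P')"
    using lim by (intro LIMSEQ_le_const2) auto
  have "?E = (\<integral>\<^sup>+ z. liminf (\<lambda>n. ennreal (c z - w n z)) \<partial>P')"
  proof (rule nn_integral_cong)
    fix z
    have "(\<lambda>n. ennreal (c z - w n z)) \<longlonglongrightarrow> ennreal (c z - (u (fst z) + v (snd z)))"
      by (intro tendsto_ennrealI tendsto_diff tendsto_const w_lim)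
    then show "ennreal (c z - (u (fst z) + v (snd z))) = liminf (\<lambda>n. ennreal (c z - w n z))"
      by (simp add: lim_imp_Liminf)
  qed
  also have "\<dots> \<le> liminf (\<lambda>n. \<integral>\<^sup>+ z. ennreal (c z - w n z) \<partial>P')"
    using T_int(4)[OF P'] c' by (intro nn_integral_liminf) auto
  also have "\<dots> = liminf (\<lambda>n. ennreal ((\<integral>z. c z \<partial>P') - (\<integral>z. w n z \<partial>P)))"
  proof -
    have "(\<integral>\<^sup>+ z. ennreal (c z - w n z) \<partial>P') = ennreal ((\<integral>z. c z \<partial>P') - (\<integral>z. w n z \<partial>P))" for n
    proof -
      have "(\<integral>\<^sup>+ z. ennreal (c z - w n z) \<partial>P') = ennreal (\<integral>z. c z - w n z \<partial>P')"
        using c' w_int[OF P'] w_le[of n] by (intro nn_integral_eq_integral) auto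
      then show ?thesis using c' w_int[OF P'] same by simp
    qed
    then show ?thesis by simp
  qed
  also have "\<dots> = ennreal ((\<integral>z. c z \<partial>P') - (\<integral>z. c z \<partial>P))"
    by (intro lim_imp_Liminf tendsto_ennrealI tendsto_diff tendsto_const lim) simp
  finally show "?E \<le> ennreal ((\<integral>z. c z \<partial>P') - (\<integral>z. c z \<partial>P))" .
qed

lemma ereal_add_eq_ereal:
  assumes "a + b = ereal r"
  shows "\<bar>a\<bar> \<noteq> \<infinity>" "\<bar>b\<bar> \<noteq> \<infinity>"
  using assms by (cases a; cases b; simp)+

text \<open>Real representatives \<open>u\<close>, \<open>v\<close> of \<open>f\<close>,
  \<open>g\<close> reduce this to \<open>slackness_excess\<close>, which bounds the integral of the
  excess \<open>c - (u + v)\<close> under \<open>P'\<close> by the gap between the two costs. The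
  first conclusion, for varying \<open>P'\<close>, yields optimality of \<open>P\<close>; this is
  how the restricted plan is later shown to be optimal.\<close>

lemma slackness:
  fixes f :: "'a \<Rightarrow> ereal" and g :: "'b \<Rightarrow> ereal" and c :: "'a \<times> 'b \<Rightarrow> real"
  assumes P: "P \<in> transport_plans M N" and P': "P' \<in> transport_plans M N"
    and f: "f \<in> borel_measurable M" and g: "g \<in> borel_measurable N"
    and c [measurable]: "c \<in> borel_measurable (M \<Otimes>\<^sub>M N)" and nonneg: "\<And>z. 0 \<le> c z"
    and fin: "(\<integral>\<^sup>+ z. ennreal (c z) \<partial>P) < \<infinity>"
    and eq: "AE z in P. f (fst z) + g (snd z) = ereal (c z)"
    and le: "\<And>x y. x \<in> space M \<Longrightarrow> y \<in> space N \<Longrightarrow> f x + g y \<le> ereal (c (x, y))"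
  shows "(\<integral>\<^sup>+ z. ennreal (c z) \<partial>P) \<le> (\<integral>\<^sup>+ z. ennreal (c z) \<partial>P')"
    and "(\<integral>\<^sup>+ z. ennreal (c z) \<partial>P') = (\<integral>\<^sup>+ z. ennreal (c z) \<partial>P) \<Longrightarrow>
      AE z in P'. f (fst z) + g (snd z) = ereal (c z)"
proof -
  define u where "u x = real_of_ereal (f x)" for x
  define v where "v x = real_of_ereal (g x)" for x
  note f [measurable] g [measurable]
  note transport_plansD(2)[OF P, measurable_cong] transport_plansD(2)[OF P', measurable_cong]
  have u [measurable]: "u \<in> borel_measurable M" and v [measurable]: "v \<in> borel_measurable N"
    unfolding u_def v_def by measurable
  \<comment> \<open>Finiteness is pushed from \<open>P\<close> down to the marginals and pulled back
    to any plan, so that \<open>u\<close> and \<open>v\<close> may replace \<open>f\<close> and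
    \<open>g\<close> under \<open>P'\<close> as well.\<close>
  have "AE z in P. \<bar>f (fst z)\<bar> \<noteq> \<infinity>"
    using eq by eventually_elim (rule ereal_add_eq_ereal(1))
  then have "AE x in distr P M fst. \<bar>f x\<bar> \<noteq> \<infinity>"
    by (subst AE_distr_iff) auto
  then have fM: "AE x in M. \<bar>f x\<bar> \<noteq> \<infinity>"
    by (simp only: transport_plansD(3)[OF P])
  have "AE z in P. \<bar>g (snd z)\<bar> \<noteq> \<infinity>"
    using eq by eventually_elim (rule ereal_add_eq_ereal(2))
  then have "AE x in distr P N snd. \<bar>g x\<bar> \<noteq> \<infinity>"
    by (subst AE_distr_iff) auto
  then have gN: "AE x in N. \<bar>g x\<bar> \<noteq> \<infinity>"
    by (simp only: transport_plansD(4)[OF P])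
  have uv: "AE z in Q. f (fst z) + g (snd z) = ereal (u (fst z) + v (snd z))"
    if "Q \<in> transport_plans M N" for Q
    using AE_transport_plan_fst[OF that fM] AE_transport_plan_snd[OF that gN]
    by eventually_elim (auto simp: u_def v_def ereal_real)
  have eq': "AE z in P. u (fst z) + v (snd z) = c z"
    using eq uv[OF P] by eventually_elim simp
  have le': "AE z in P'. u (fst z) + v (snd z) \<le> c z"
    using uv[OF P'] AE_space
  proof eventually_elim
    case (elim z)
    then show ?case using le[of "fst z" "snd z"] space_transport_plan[OF P'] by auto
  qed
  have c_int: "integrable Q c" if "Q \<in> transport_plans M N" "(\<integral>\<^sup>+ z. ennreal (c z) \<partial>Q) < \<infinity>" for Q
  proof -
    note transport_plansD(2)[OF that(1), measurable_cong]
    show ?thesis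
      by (rule integrableI_nonneg) (use that(2) nonneg in auto)
  qed
  note excess = slackness_excess[OF P P' u v c_int[OF P fin] _ nonneg eq' le']
  have int_eq: "(\<integral>\<^sup>+ z. ennreal (c z) \<partial>Q) = ennreal (\<integral>z. c z \<partial>Q)" if "integrable Q c" for Q
    using that nonneg by (intro nn_integral_eq_integral) auto
  show "(\<integral>\<^sup>+ z. ennreal (c z) \<partial>P) \<le> (\<integral>\<^sup>+ z. ennreal (c z) \<partial>P')"
  proof (cases "(\<integral>\<^sup>+ z. ennreal (c z) \<partial>P') < \<infinity>")
    case True
    note c' = c_int[OF P' True]
    show ?thesis
      unfolding int_eq[OF c'] int_eq[OF c_int[OF P fin]] by (rule ennreal_leI[OF excess(2)[OF c']])
  qed (simp add: not_less top_unique)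
  assume same: "(\<integral>\<^sup>+ z. ennreal (c z) \<partial>P') = (\<integral>\<^sup>+ z. ennreal (c z) \<partial>P)"
  have c': "integrable P' c" using c_int[OF P'] same fin by simp
  have "(\<integral>z. c z \<partial>P') = (\<integral>z. c z \<partial>P)"
    using same unfolding int_eq[OF c'] int_eq[OF c_int[OF P fin]]
    by (simp add: nonneg integral_nonneg_AE)
  then have "(\<integral>\<^sup>+ z. ennreal (c z - (u (fst z) + v (snd z))) \<partial>P') = 0"
    using excess(1)[OF c'] by simp
  then have "AE z in P'. ennreal (c z - (u (fst z) + v (snd z))) = 0"
    by (subst (asm) nn_integral_0_iff_AE) auto
  \<comment> \<open>A zero excess in \<open>ennreal\<close> only says \<open>c \<le> u + v\<close>;
    the reverse inequality is \<open>le'\<close>.\<close>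
  then show "AE z in P'. f (fst z) + g (snd z) = ereal (c z)"
    using le' uv[OF P'] by eventually_elim (auto simp: ennreal_eq_0_iff)
qed

section \<open>From an integral identity to almost sure equality\<close>

text \<open>\<open>e2ennreal\<close> cuts off at 0, so with A and B the integrals of the positive
  and negative parts of \<open>h\<close> and C that of \<open>c\<close>, the hypothesis reads C = A
  - B. As \<open>h \<le> c\<close> gives A \<le> C < \<infinity>, it forces B = 0 and A = C. Hence
  \<open>h\<close> is nonnegative and its positive part equals \<open>c\<close> almost
  surely.\<close>

lemma AE_eq_of_ereal_integral_eq:
  fixes h :: "'a \<Rightarrow> ereal" and c :: "'a \<Rightarrow> real"
  assumes h [measurable]: "h \<in> borel_measurable P" and c [measurable]: "c \<in> borel_measurable P"
    and nonneg: "\<And>z. 0 \<le> c z"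
    and fin: "(\<integral>\<^sup>+ z. ennreal (c z) \<partial>P) < \<infinity>"
    and le: "\<And>z. z \<in> space P \<Longrightarrow> h z \<le> ereal (c z)"
    and eq: "enn2ereal (\<integral>\<^sup>+ z. ennreal (c z) \<partial>P) = ereal_integral P h"
  shows "AE z in P. h z = ereal (c z)"
proof -
  let ?A = "\<integral>\<^sup>+ z. e2ennreal (h z) \<partial>P" and ?B = "\<integral>\<^sup>+ z. e2ennreal (- h z) \<partial>P"
    and ?C = "\<integral>\<^sup>+ z. ennreal (c z) \<partial>P"
  have hc: "e2ennreal (h z) \<le> ennreal (c z)" if "z \<in> space P" for z
    using e2ennreal_mono[OF le[OF that]] by simp
  have AC: "?A \<le> ?C" by (rule nn_integral_mono) (rule hc)
  obtain a where a: "?A = ennreal a" "0 \<le> a" using AC fin by (cases ?A) (auto simp: top_unique)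
  obtain r where r: "?C = ennreal r" "0 \<le> r" using fin by (cases ?C) auto
  \<comment> \<open>An infinite \<open>?B\<close> would make the difference
    \<open>-\<infinity>\<close>, while \<open>?C\<close> is nonnegative.\<close>
  have B: "?B \<noteq> top"
    using eq a r by (auto simp: ereal_integral_def enn2ereal_ennreal)
  then obtain b where b: "?B = ennreal b" "0 \<le> b" by (cases ?B) auto
  have "r = a - b" using eq a r b by (simp add: ereal_integral_def enn2ereal_ennreal)
  moreover have "a \<le> r" using AC a r by simp
  ultimately have "b = 0" "a = r" using b by auto
  then have B0: "?B = 0" and AC': "?A = ?C" using a b r by auto
  have 1: "AE z in P. e2ennreal (- h z) = 0"
    using B0 by (subst (asm) nn_integral_0_iff_AE) auto
  have "(\<integral>\<^sup>+ z. ennreal (c z) - e2ennreal (h z) \<partial>P) = ?C - ?A"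
    using a by (intro nn_integral_diff) (auto intro: hc)
  then have "(\<integral>\<^sup>+ z. ennreal (c z) - e2ennreal (h z) \<partial>P) = 0"
    using AC' fin by simp
  then have 2: "AE z in P. ennreal (c z) - e2ennreal (h z) = 0"
    by (subst (asm) nn_integral_0_iff_AE) auto
  show ?thesis using 1 2 AE_space
  proof eventually_elim
    case (elim z)
    have "enn2ereal (e2ennreal (- h z)) = 0" using elim by (simp add: zero_ennreal.rep_eq)
    then have "h z \<ge> 0" by (cases "h z \<ge> 0") (auto simp: enn2ereal_e2ennreal ereal_uminus_le_reorder not_le)
    moreover have "ennreal (c z) \<le> e2ennreal (h z)" using elim(2) by (simp add: diff_eq_0_iff_ennreal)
    ultimately have "ereal (c z) \<le> h z"
      using nonneg[of z] by (metis enn2ereal_e2ennreal e2ennreal_ereal ereal_less_eq(5) less_eq_ennreal.rep_eq)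
    then show ?case using le elim(3) by (simp add: antisym)
  qed
qed


text \<open>Supplies the integral condition in the definition of a potential when almost sure
  equality with the cost is known.\<close>

lemma ereal_integral_AE_eq:
  assumes "AE z in P. h z = ereal (c z)" and "\<And>z. 0 \<le> c z"
  shows "ereal_integral P h = enn2ereal (\<integral>\<^sup>+ z. ennreal (c z) \<partial>P)"
proof -
  have "(\<integral>\<^sup>+ z. e2ennreal (h z) \<partial>P) = (\<integral>\<^sup>+ z. ennreal (c z) \<partial>P)"
    by (rule nn_integral_cong_AE) (use assms(1) in \<open>eventually_elim, simp\<close>)
  moreover have "(\<integral>\<^sup>+ z. e2ennreal (- h z) \<partial>P) = (\<integral>\<^sup>+ z. 0 \<partial>P)"
    by (rule nn_integral_cong_AE)
      (use assms(1) in \<open>eventually_elim, simp add: assms(2) ennreal_neg\<close>)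
  ultimately show ?thesis by (simp add: ereal_integral_def zero_ennreal.rep_eq)
qed

section \<open>Measurability and basic inequality of c-transforms\<close>

text \<open>\<open>Y\<close> may be uncountable, so measurability comes from upper semicontinuity:
  the strict sublevel sets are unions of open sets. Where \<open>g y\<close> is infinite, the term
  does not depend on \<open>x\<close>.\<close>

lemma borel_measurable_INF_continuous_diff:
  fixes c :: "'a::topological_space \<Rightarrow> 'b \<Rightarrow> real" and g :: "'b \<Rightarrow> ereal"
  assumes cont: "\<And>y. y \<in> Y \<Longrightarrow> continuous_on UNIV (\<lambda>x. c x y)"
  shows "(\<lambda>x. INF y\<in>Y. ereal (c x y) - g y) \<in> borel_measurable borel"
proof (rule borel_measurableI_less)
  fix t :: ereal
  have "open {x. ereal (c x y) - g y < t}" if "y \<in> Y" for y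
  proof (cases "g y")
    case (real r)
    have "continuous_on UNIV (\<lambda>x. ereal (c x y - r))"
      using cont[OF that] by (intro continuous_intros)
    then have "open {x. ereal (c x y - r) < t}"
      by (intro open_Collect_less continuous_on_const)
    then show ?thesis using real by simp
  qed simp_all
  moreover have "{x. (INF y\<in>Y. ereal (c x y) - g y) < t} = (\<Union>y\<in>Y. {x. ereal (c x y) - g y < t})"
    by (auto simp: INF_less_iff)
  ultimately have "open {x. (INF y\<in>Y. ereal (c x y) - g y) < t}"
    by auto
  then show "{x \<in> space borel. (INF y\<in>Y. ereal (c x y) - g y) < t} \<in> sets borel"
    by simp
qed

lemma borel_measurable_ctransform_X:
  fixes c :: "'a::topological_space \<times> 'b::topological_space \<Rightarrow> real"
  assumes "continuous_on UNIV c"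
  shows "ctransform_X X c f \<in> borel_measurable borel"
  unfolding ctransform_X_def
  by (rule borel_measurable_INF_continuous_diff[where c="\<lambda>y x. c (x, y)"])
    (intro continuous_on_compose2[OF assms] continuous_intros; simp)

lemma borel_measurable_ctransform_Y:
  fixes c :: "'a::topological_space \<times> 'b::topological_space \<Rightarrow> real"
  assumes "continuous_on UNIV c"
  shows "ctransform_Y Y c g \<in> borel_measurable borel"
  unfolding ctransform_Y_def
  by (rule borel_measurable_INF_continuous_diff[where c="\<lambda>x y. c (x, y)"])
    (intro continuous_on_compose2[OF assms] continuous_intros; simp)

text \<open>In \<open>ereal\<close>, \<open>-\<infinity> + \<infinity>\<close> is
  \<open>\<infinity>\<close>, so the bound could fail where \<open>f x\<close> is
  \<open>-\<infinity>\<close>. The point \<open>x0\<close>, at which \<open>f\<close> is finite,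
  keeps the infimum below \<open>\<infinity>\<close> and rules this out.\<close>

lemma add_ctransform_X_le:
  assumes "x0 \<in> X" "f x0 \<noteq> -\<infinity>" and "x \<in> X" "f x \<noteq> \<infinity>" "f x0 \<noteq> \<infinity>"
  shows "f x + ctransform_X X c f y \<le> ereal (c (x, y))"
proof -
  have le: "ctransform_X X c f y \<le> ereal (c (x', y)) - f x'" if "x' \<in> X" for x'
    unfolding ctransform_X_def using that by (rule INF_lower)
  have "ctransform_X X c f y \<noteq> \<infinity>"
    using le[OF assms(1)] assms(2,5) by (cases "f x0") auto
  then show ?thesis
    using le[OF assms(3)] assms(4)
    by (cases "f x"; cases "ctransform_X X c f y") (auto simp: algebra_simps)
qed

lemma c_concave_add_ctransform_X_le:
  assumes "c_concave X Y c f" "x \<in> X"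
  shows "f x + ctransform_X X c f y \<le> ereal (c (x, y))"
proof -
  obtain x0 where "x0 \<in> X" "f x0 \<noteq> -\<infinity>" using assms(1) by (auto simp: c_concave_def)
  then show ?thesis
    using assms by (intro add_ctransform_X_le[of x0]) (auto simp: c_concave_def)
qed

section \<open>Potentials under an arbitrary optimal plan\<close>

text \<open>The definition gives the integral identity for some optimal plan \<open>P\<close>. There
  it becomes almost sure equality, which \<open>slackness\<close> carries over to the prescribed
  \<open>\<pi>\<close>, a plan of the same cost.\<close>

lemma kantorovich_potential_slack:
  fixes \<mu> :: "'a::second_countable_topology measure" and \<nu> :: "'b::second_countable_topology measure"
  assumes \<mu>: "sets \<mu> = sets borel" and \<nu>: "sets \<nu> = sets borel"
    and cont: "continuous_on UNIV c" and nonneg: "\<And>z. 0 \<le> c z"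
    and fin: "transport_cost c \<mu> \<nu> < \<infinity>"
    and f: "f \<in> kantorovich_potentials c \<mu> \<nu>" and \<pi>: "optimal_plan c \<mu> \<nu> \<pi>"
  shows "f \<in> borel_measurable \<mu>" and "\<And>x y. f x + ctransform_X UNIV c f y \<le> ereal (c (x, y))"
    and "AE z in \<pi>. f (fst z) + ctransform_X UNIV c f (snd z) = ereal (c z)"
proof -
  have sp: "space \<mu> = UNIV" "space \<nu> = UNIV"
    using sets_eq_imp_space_eq[OF \<mu>] sets_eq_imp_space_eq[OF \<nu>] by auto
  have conc: "c_concave UNIV UNIV c f" using f by (simp add: kantorovich_potentials_def sp)
  then obtain g where "\<And>x. f x = ctransform_Y UNIV c g x" by (auto simp: c_concave_def)
  then have "f = ctransform_Y UNIV c g" by auto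
  then have fb: "f \<in> borel_measurable borel" using borel_measurable_ctransform_Y[OF cont] by simp
  then show fm: "f \<in> borel_measurable \<mu>" using measurable_cong_sets[OF \<mu> refl] by auto
  have gm: "ctransform_X UNIV c f \<in> borel_measurable \<nu>"
    using borel_measurable_ctransform_X[OF cont] measurable_cong_sets[OF \<nu> refl] by auto
  have cm: "c \<in> borel_measurable (\<mu> \<Otimes>\<^sub>M \<nu>)"
    using borel_measurable_continuous_onI[OF cont]
    by (simp add: borel_prod[symmetric] measurable_cong_sets[OF sets_pair_measure_cong[OF \<mu> \<nu>] refl])
  show le: "f x + ctransform_X UNIV c f y \<le> ereal (c (x, y))" for x y
    using c_concave_add_ctransform_X_le[OF conc] by simp
  obtain P where P: "optimal_plan c \<mu> \<nu> P" and eq: "enn2ereal (transport_cost c \<mu> \<nu>) =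
      ereal_integral P (\<lambda>(x, y). f x + ctransform_X UNIV c f y)"
    using f by (auto simp: kantorovich_potentials_def sp)
  have tP: "P \<in> transport_plans \<mu> \<nu>" and costP: "(\<integral>\<^sup>+ z. ennreal (c z) \<partial>P) = transport_cost c \<mu> \<nu>"
    using P by (auto simp: optimal_plan_def)
  have t\<pi>: "\<pi> \<in> transport_plans \<mu> \<nu>" and cost\<pi>: "(\<integral>\<^sup>+ z. ennreal (c z) \<partial>\<pi>) = transport_cost c \<mu> \<nu>"
    using \<pi> by (auto simp: optimal_plan_def)
  have "AE z in P. f (fst z) + ctransform_X UNIV c f (snd z) = ereal (c z)"
  proof (rule AE_eq_of_ereal_integral_eq)
    note transport_plansD(2)[OF tP, measurable_cong] fm[measurable] gm[measurable]
    show "(\<lambda>z. f (fst z) + ctransform_X UNIV c f (snd z)) \<in> borel_measurable P" by measurable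
    show "c \<in> borel_measurable P" using cm by measurable
  qed (use eq costP fin nonneg le in \<open>auto simp: case_prod_unfold\<close>)
  then show "AE z in \<pi>. f (fst z) + ctransform_X UNIV c f (snd z) = ereal (c z)"
    using slackness(2)[OF tP t\<pi> fm gm cm nonneg] costP cost\<pi> fin le by simp
qed

section \<open>Restriction of a potential to a piece\<close>

lemma AE_scale_measureI:
  assumes "AE x in M. P x"
  shows "AE x in scale_measure r M. P x"
proof -
  obtain N where "{x\<in>space M. \<not> P x} \<subseteq> N" "N \<in> null_sets M"
    using assms by (auto simp: eventually_ae_filter)
  then show ?thesis
    by (intro AE_I'[of N]) (auto simp: null_sets_def space_scale_measure)
qed

lemma AE_scale_measureD:
  assumes "AE x in scale_measure r M. P x" "r \<noteq> 0"
  shows "AE x in M. P x"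
proof -
  obtain N where "{x\<in>space M. \<not> P x} \<subseteq> N" "N \<in> null_sets (scale_measure r M)"
    using assms(1) by (auto simp: eventually_ae_filter space_scale_measure)
  then show ?thesis
    using assms(2) by (intro AE_I'[of N]) (auto simp: null_sets_def)
qed

text \<open>The normalised restriction of \<open>\<pi>\<close> to \<open>A \<times> UNIV\<close>
  couples the two pieces, and \<open>f\<close> plus its full transform still equals \<open>c\<close>
  almost surely there. By \<open>slackness\<close> this coupling is optimal, and the equality
  persists when the infimum in the transform runs over \<open>A\<close> alone.\<close>

lemma kantorovich_potential_piece:
  fixes \<mu> :: "'a::second_countable_topology measure" and \<nu> :: "'b::second_countable_topology measure"
  assumes prob: "prob_space \<mu>" and \<mu>: "sets \<mu> = sets borel" and \<nu>: "sets \<nu> = sets borel"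
    and cont: "continuous_on UNIV c" and nonneg: "\<And>z. 0 \<le> c z"
    and fin: "transport_cost c \<mu> \<nu> < \<infinity>"
    and f: "f \<in> kantorovich_potentials c \<mu> \<nu>" and \<pi>: "optimal_plan c \<mu> \<nu> \<pi>"
    and A: "A \<in> sets \<mu>" "emeasure \<mu> A \<noteq> 0"
  shows "f \<in> kantorovich_potentials c (source_piece \<mu> A) (target_piece \<mu> \<nu> \<pi> A)"
proof -
  let ?S = "source_piece \<mu> A" and ?T = "target_piece \<mu> \<nu> \<pi> A" and ?m = "emeasure \<mu> A"
  let ?R = "restrict_space \<pi> (A \<times> space \<nu>)"
  interpret \<mu>: prob_space \<mu> by fact
  have sp: "space \<mu> = UNIV" "space \<nu> = UNIV"
    using sets_eq_imp_space_eq[OF \<mu>] sets_eq_imp_space_eq[OF \<nu>] by auto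
  have m_fin: "?m < top" unfolding less_top[symmetric] using \<mu>.emeasure_finite[of A] by simp
  have t\<pi>: "\<pi> \<in> transport_plans \<mu> \<nu>" and cost\<pi>: "(\<integral>\<^sup>+ z. ennreal (c z) \<partial>\<pi>) = transport_cost c \<mu> \<nu>"
    using \<pi> by (auto simp: optimal_plan_def)
  interpret \<pi>: prob_space \<pi> using transport_plansD(1)[OF t\<pi>] .
  note \<pi>_sets = transport_plansD(2)[OF t\<pi>]
  have \<pi>_space: "space \<pi> = UNIV" using space_transport_plan[OF t\<pi>] sp by simp
  have S_sets: "sets ?S = sets (restrict_space \<mu> A)" and S_space: "space ?S = A"
    by (auto simp: source_piece_def space_scale_measure space_restrict_space sp)
  have T_sets: "sets ?T = sets \<nu>" and T_space: "space ?T = UNIV"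
    by (auto simp: target_piece_def space_scale_measure sp)
  have cm: "c \<in> borel_measurable (\<mu> \<Otimes>\<^sub>M \<nu>)"
    using borel_measurable_continuous_onI[OF cont]
    by (simp add: borel_prod[symmetric] measurable_cong_sets[OF sets_pair_measure_cong[OF \<mu> \<nu>] refl])
  have gm: "ctransform_X UNIV c f \<in> borel_measurable \<nu>"
    using borel_measurable_ctransform_X[OF cont] measurable_cong_sets[OF \<nu> refl] by auto
  note slack = kantorovich_potential_slack[OF \<mu> \<nu> cont nonneg fin f \<pi>]
  have id_S: "(\<lambda>x. x) \<in> ?S \<rightarrow>\<^sub>M \<mu>"
    unfolding measurable_cong_sets[OF S_sets refl] by (rule measurable_restrict_space1) simp
  have id_T: "(\<lambda>x. x) \<in> ?T \<rightarrow>\<^sub>M \<nu>" using T_sets by (simp add: measurable_ident_sets)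
  have fmS: "f \<in> borel_measurable ?S" using measurable_compose[OF id_S slack(1)] by simp
  have gmT: "ctransform_X UNIV c f \<in> borel_measurable ?T" using measurable_compose[OF id_T gm] by simp
  have "(\<lambda>z. (fst z, snd z)) \<in> ?S \<Otimes>\<^sub>M ?T \<rightarrow>\<^sub>M \<mu> \<Otimes>\<^sub>M \<nu>"
    by (intro measurable_Pair measurable_compose[OF measurable_fst id_S]
        measurable_compose[OF measurable_snd id_T])
  from measurable_compose[OF this cm] have cmST: "c \<in> borel_measurable (?S \<Otimes>\<^sub>M ?T)" by simp
  have AT: "A \<times> space \<nu> \<inter> space \<pi> \<in> sets \<pi>" using A(1) sets.top[of \<nu>] by (auto simp: \<pi>_sets \<pi>_space sp)
  have R_space: "space ?R = A \<times> UNIV" by (auto simp: space_restrict_space \<pi>_space sp)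
  define Q where "Q = scale_measure (1 / ?m) ?R"
  have Q_space: "space Q = A \<times> UNIV" by (simp add: Q_def space_scale_measure R_space)
  have "fst \<in> ?R \<rightarrow>\<^sub>M restrict_space \<mu> A"
    by (rule measurable_restrict_space3)
      (auto simp: measurable_cong_sets[OF \<pi>_sets refl])
  moreover have "snd \<in> ?R \<rightarrow>\<^sub>M \<nu>"
    by (rule measurable_restrict_space1) (auto simp: measurable_cong_sets[OF \<pi>_sets refl])
  ultimately have "(\<lambda>z. (fst z, snd z)) \<in> ?R \<rightarrow>\<^sub>M restrict_space \<mu> A \<Otimes>\<^sub>M \<nu>"
    by (rule measurable_Pair)
  then have idQ: "(\<lambda>z. z) \<in> Q \<rightarrow>\<^sub>M ?S \<Otimes>\<^sub>M ?T"
    by (simp add: Q_def measurable_cong_sets[OF sets_scale_measure sets_pair_measure_cong[OF S_sets T_sets]])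
  \<comment> \<open>The identity map carries \<open>Q\<close> to the product sigma-algebra of the
    two pieces, on which \<open>transport_plans\<close> requires plans to live.\<close>
  define P where "P = distr Q (?S \<Otimes>\<^sub>M ?T) (\<lambda>z. z)"
  have P_sets: "sets P = sets (?S \<Otimes>\<^sub>M ?T)" by (simp add: P_def)
  \<comment> \<open>Rectangles suffice: the preimages that determine the marginals have the form
    \<open>B \<times> UNIV\<close> or \<open>A \<times> B\<close>.\<close>
  have P_rect: "emeasure P (B \<times> D) = emeasure \<pi> (B \<times> D) / ?m" if "B \<in> sets \<mu>" "B \<subseteq> A" "D \<in> sets \<nu>" for B D
  proof -
    have "B \<in> sets ?S" unfolding S_sets sets_restrict_space_iff
      using that by (auto simp: sets_restrict_space)
    then have BD: "B \<times> D \<in> sets (?S \<Otimes>\<^sub>M ?T)" using that T_sets by auto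
    have "emeasure P (B \<times> D) = emeasure Q (B \<times> D)"
      unfolding P_def emeasure_distr[OF idQ BD]
      by (rule arg_cong[where f="emeasure Q"]) (use that in \<open>auto simp: Q_space\<close>)
    also have "\<dots> = (1 / ?m) * emeasure \<pi> (B \<times> D)"
      unfolding Q_def emeasure_scale_measure
      by (subst emeasure_restrict_space[OF AT]) (use that in \<open>auto simp: sp\<close>)
    finally show ?thesis by (simp only: divide_ennreal_def mult_1_left mult.commute)
  qed
  have marg: "emeasure \<pi> (B \<times> UNIV) = emeasure \<mu> B" if "B \<in> sets \<mu>" for B
  proof -
    have "emeasure \<mu> B = emeasure (distr \<pi> \<mu> fst) B" using transport_plansD(3)[OF t\<pi>] by simp
    also have "\<dots> = emeasure \<pi> (fst -` B \<inter> space \<pi>)"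
      by (rule emeasure_distr[OF _ that]) (auto simp: measurable_cong_sets[OF \<pi>_sets refl])
    also have "fst -` B \<inter> space \<pi> = B \<times> UNIV" by (auto simp: \<pi>_space)
    finally show ?thesis ..
  qed
  have plan: "P \<in> transport_plans ?S ?T"
    unfolding transport_plans_def mem_Collect_eq
  proof (intro conjI P_sets)
    have P_space: "space P = A \<times> UNIV"
      by (simp add: P_def space_pair_measure S_space T_space)
    have "emeasure P (A \<times> UNIV) = 1"
      using P_rect[of A UNIV] A marg[OF A(1)] sp sets.top[of \<nu>]
        ennreal_divide_self[OF A(2) m_fin] by simp
    then show "prob_space P" by (intro prob_spaceI) (simp add: P_space)
    note P_sets[measurable_cong]
    show "distr P ?S fst = ?S"
    proof (rule measure_eqI)
      fix B assume "B \<in> sets (distr P ?S fst)"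
      then have B: "B \<in> sets ?S" by simp
      then have B': "B \<in> sets \<mu>" "B \<subseteq> A"
        using A(1) by (auto simp: S_sets sets_restrict_space_iff sets.Int_space_eq2)
      have "emeasure (distr P ?S fst) B = emeasure P (fst -` B \<inter> space P)"
        by (rule emeasure_distr[OF _ B]) measurable
      also have "fst -` B \<inter> space P = B \<times> UNIV" using B' by (auto simp: P_space)
      finally show "emeasure (distr P ?S fst) B = emeasure ?S B"
        using P_rect[OF B', of UNIV] marg[OF B'(1)] sets.top[of \<nu>] sp
          emeasure_source_piece[OF A(1) B'] by simp
    qed simp
    show "distr P ?T snd = ?T"
    proof (rule measure_eqI)
      fix B assume "B \<in> sets (distr P ?T snd)"
      then have B: "B \<in> sets ?T" by simp
      then have B': "B \<in> sets \<nu>" by (simp add: T_sets)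
      have "emeasure (distr P ?T snd) B = emeasure P (snd -` B \<inter> space P)"
        by (rule emeasure_distr[OF _ B]) measurable
      also have "snd -` B \<inter> space P = A \<times> B" by (auto simp: P_space)
      finally show "emeasure (distr P ?T snd) B = emeasure ?T B"
        using P_rect[OF A(1) order_refl B'] emeasure_target_piece[OF \<pi>_sets A(1) B'] by simp
    qed simp
  qed
  have AE_P: "AE z in P. f (fst z) + ctransform_X UNIV c f (snd z) = ereal (c z)"
  proof -
    note cmST[measurable] fmS[measurable] gmT[measurable]
    have "AE z in ?R. f (fst z) + ctransform_X UNIV c f (snd z) = ereal (c z)"
      unfolding AE_restrict_space_iff[OF AT] using slack(3) by eventually_elim simp
    then have "AE z in Q. f (fst z) + ctransform_X UNIV c f (snd z) = ereal (c z)"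
      unfolding Q_def by (rule AE_scale_measureI)
    then show ?thesis
      unfolding P_def by (subst AE_distr_iff[OF idQ]) measurable
  qed
  \<comment> \<open>Normalisation raises the total cost by at most the finite factor
    \<open>1 / ?m\<close>.\<close>
  have costP: "(\<integral>\<^sup>+ z. ennreal (c z) \<partial>P) < \<infinity>"
  proof -
    have cR: "(\<lambda>z. ennreal (c z)) \<in> borel_measurable ?R"
      by (intro measurable_restrict_space1) (use cm in \<open>simp add: measurable_cong_sets[OF \<pi>_sets refl]\<close>)
    have "(\<integral>\<^sup>+ z. ennreal (c z) \<partial>P) = (\<integral>\<^sup>+ z. ennreal (c z) \<partial>Q)"
      unfolding P_def by (rule nn_integral_distr[OF idQ]) (use cmST in simp)
    also have "\<dots> = (1 / ?m) * (\<integral>\<^sup>+ z. ennreal (c z) \<partial>?R)"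
      unfolding Q_def by (rule nn_integral_scale_measure[OF cR])
    also have "(\<integral>\<^sup>+ z. ennreal (c z) \<partial>?R) \<le> (\<integral>\<^sup>+ z. ennreal (c z) \<partial>\<pi>)"
      unfolding nn_integral_restrict_space[OF AT]
      by (intro nn_integral_mono) (auto simp: indicator_def)
    finally have "(\<integral>\<^sup>+ z. ennreal (c z) \<partial>P) \<le> (1 / ?m) * transport_cost c \<mu> \<nu>"
      by (simp add: mult_left_mono cost\<pi>)
    also have "\<dots> < \<infinity>"
      using fin A(2) by (auto simp: ennreal_mult_eq_top_iff ennreal_divide_eq_top_iff less_top[symmetric])
    finally show ?thesis .
  qed
  have "(\<integral>\<^sup>+ z. ennreal (c z) \<partial>P) \<le> (\<integral>\<^sup>+ z. ennreal (c z) \<partial>P')" if "P' \<in> transport_plans ?S ?T" for P'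
    by (rule slackness(1)[OF plan that fmS gmT cmST nonneg costP AE_P]) (rule slack(2))
  then have cost: "transport_cost c ?S ?T = (\<integral>\<^sup>+ z. ennreal (c z) \<partial>P)"
    unfolding transport_cost_def by (intro antisym INF_lower INF_greatest plan)
  then have opt: "optimal_plan c ?S ?T P" using plan by (simp add: optimal_plan_def)
  have conc: "c_concave A UNIV c f"
  proof -
    have "c_concave UNIV UNIV c f" using f by (simp add: kantorovich_potentials_def sp)
    \<comment> \<open>The function giving c-concavity on the whole space serves on \<open>A\<close>
      too. If \<open>f\<close> were \<open>-\<infinity>\<close> throughout \<open>A\<close>, its sum
      with the transform could not equal the real cost \<open>P\<close>-almost surely.\<close>
    moreover have "\<exists>x\<in>A. f x \<noteq> -\<infinity>"
    proof (rule ccontr)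
      assume "\<not> ?thesis"
      then have minf: "f x = -\<infinity>" if "x \<in> A" for x using that by blast
      have "AE z in P. False"
        using AE_P AE_space
      proof eventually_elim
        case (elim z)
        then have "f (fst z) = -\<infinity>"
          by (intro minf) (auto simp: space_transport_plan[OF plan] S_space)
        then show False using ereal_add_eq_ereal(1)[OF elim(1)] by simp
      qed
      then show False
        using prob_space.AE_False[OF transport_plansD(1)[OF plan]] by simp
    qed
    ultimately show ?thesis unfolding c_concave_def by blast
  qed
  \<comment> \<open>Shrinking the index set to \<open>A\<close> can only raise the infimum, so the
    new sum is at least \<open>c\<close>; the general bound on \<open>A\<close> makes it at most
    \<open>c\<close>.\<close>
  have "AE z in P. f (fst z) + ctransform_X A c f (snd z) = ereal (c z)"
    using AE_P AE_space
  proof eventually_elim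
    case (elim z)
    then have "fst z \<in> A" by (auto simp: space_transport_plan[OF plan] S_space)
    then have "f (fst z) + ctransform_X A c f (snd z) \<le> ereal (c z)"
      using c_concave_add_ctransform_X_le[OF conc, of "fst z" "snd z"] by simp
    moreover have "ctransform_X UNIV c f (snd z) \<le> ctransform_X A c f (snd z)"
      unfolding ctransform_X_def by (rule INF_superset_mono) auto
    then have "ereal (c z) \<le> f (fst z) + ctransform_X A c f (snd z)"
      unfolding elim(1)[symmetric] by (rule add_left_mono)
    ultimately show ?case by (rule antisym)
  qed
  from ereal_integral_AE_eq[OF this nonneg] show ?thesis
    using conc opt cost
    by (auto simp: kantorovich_potentials_def S_space T_space case_prod_unfold)
qed

lemma AE_source_pieceD:
  assumes "AE x in source_piece M A. P x" "A \<in> sets M" "emeasure M A \<noteq> top"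
  shows "AE x in M. x \<in> A \<longrightarrow> P x"
proof -
  \<comment> \<open>The factor \<open>1 / emeasure M A\<close> is nonzero because \<open>A\<close>
    has finite mass, so null sets can be carried back.\<close>
  have "AE x in restrict_space M A. P x"
    using assms(1) unfolding source_piece_def
    by (rule AE_scale_measureD) (use assms(3) in \<open>simp add: divide_ennreal_def ennreal_inverse_eq_0_iff\<close>)
  then show ?thesis
    using assms(2) by (subst (asm) AE_restrict_space_iff) auto
qed

section \<open>Components and open subsets of the support\<close>

text \<open>The other components are relatively closed and finite in number, so their union is
  closed and its complement \<open>C\<close> is open.\<close>

lemma openin_component_finite:
  assumes "finite (components S)" "C \<in> components S"
  shows "openin (top_of_set S) C"
proof -
  have "closedin (top_of_set S) (\<Union>(components S - {C}))"
    using assms(1) by (intro closedin_Union) (auto intro: closedin_component)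
  moreover have "S - \<Union>(components S - {C}) = C"
    using assms(2) Union_components[of S] components_nonoverlap[of C S] by blast
  ultimately show ?thesis
    by (metis openin_diff openin_subtopology_self)
qed

text \<open>Otherwise the complement of \<open>U\<close> would be a closed set of full measure and
  contain the support.\<close>

lemma emeasure_open_Int_support:
  fixes M :: "'a::second_countable_topology measure"
  assumes "sets M = sets borel" "open U" "U \<inter> support M \<noteq> {}"
  shows "emeasure M U \<noteq> 0"
proof
  assume "emeasure M U = 0"
  then have "U \<in> null_sets M" using assms by auto
  then have "emeasure M (space M - U) = emeasure M (space M)"
    by (rule emeasure_Diff_null_set) simp
  then have "support M \<subseteq> - U"
    using assms(2) sets_eq_imp_space_eq[OF assms(1)] unfolding support_def
    by (intro Inter_lower) (auto simp: Compl_eq_Diff_UNIV)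
  then show False using assms(3) by auto
qed

lemma AE_support:
  fixes M :: "'a::second_countable_topology measure"
  assumes "sets M = sets borel" "prob_space M"
  shows "AE x in M. x \<in> support M"
proof -
  interpret prob_space M by fact
  have "support M \<in> sets M" using assms(1) closed_support[of M] by (simp add: borel_closed)
  moreover have "prob (support M) = 1"
    using support_full[OF assms(1)] emeasure_space_1 finite_measure_axioms by (simp add: measure_def)
  ultimately show ?thesis by (simp add: AE_in_set_eq_1)
qed

text \<open>\<open>C\<close> is the trace of an open set on the support, and the support has full
  measure, so both sets have the same mass.\<close>

lemma emeasure_openin_support:
  fixes M :: "'a::second_countable_topology measure"
  assumes "sets M = sets borel" "prob_space M" "openin (top_of_set (support M)) C" "C \<noteq> {}"
  shows "emeasure M C \<noteq> 0"
proof -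
  obtain U where U: "open U" "C = support M \<inter> U" using assms(3) openin_open by blast
  have "C \<in> sets M" using assms(1) closed_support[of M] U by (auto intro: borel_closed)
  have "emeasure M U = emeasure M C"
    using AE_support[OF assms(1,2)] \<open>C \<in> sets M\<close> assms(1) U
    by (intro emeasure_eq_AE) auto
  then show ?thesis using emeasure_open_Int_support[OF assms(1) U(1)] U(2) assms(4) by (auto simp: Int_commute)
qed

section \<open>Comparing the constants of the pieces\<close>

theorem theorem1:
  fixes \<mu> :: "'a::polish_space measure"
    and \<nu> :: "'b::polish_space measure"
    and c :: "'a \<times> 'b \<Rightarrow> real"
  assumes "prob_space \<mu>" and "sets \<mu> = sets borel"
    and "prob_space \<nu>" and "sets \<nu> = sets borel"
    and "continuous_on UNIV c" and "\<And>z. 0 \<le> c z"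
    and "transport_cost c \<mu> \<nu> < \<infinity>"
    and "finite (components (support \<mu>))"
    and "finite (components (support \<nu>))"
    and "\<And>f. f \<in> kantorovich_potentials c \<mu> \<nu> \<Longrightarrow>
           (\<forall>y \<in> support \<nu>. \<bar>ctransform_X UNIV c f y\<bar> \<noteq> \<infinity>) \<and>
           continuous_on (support \<nu>) (ctransform_X UNIV c f)"
    and "nondegenerate \<mu> \<nu>"
    and "\<exists>\<pi>. optimal_plan c \<mu> \<nu> \<pi> \<and>
           (\<forall>X\<^sub>i \<in> components (support \<mu>).
              unique_kantorovich_potentials c (source_piece \<mu> X\<^sub>i) (target_piece \<mu> \<nu> \<pi> X\<^sub>i))"
  shows "unique_kantorovich_potentials c \<mu> \<nu>"
proof -
  interpret \<mu>: prob_space \<mu> by fact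
  interpret \<nu>: prob_space \<nu> by fact
  note \<mu> = assms(2) and \<nu> = assms(4)
  have sp: "space \<mu> = UNIV" "space \<nu> = UNIV"
    using sets_eq_imp_space_eq[OF \<mu>] sets_eq_imp_space_eq[OF \<nu>] by auto
  let ?I = "components (support \<mu>)" and ?J = "components (support \<nu>)"
  obtain \<pi> where \<pi>: "optimal_plan c \<mu> \<nu> \<pi>"
    and uniq: "\<And>C. C \<in> ?I \<Longrightarrow>
      unique_kantorovich_potentials c (source_piece \<mu> C) (target_piece \<mu> \<nu> \<pi> C)"
    using assms(12) by blast
  have t\<pi>: "\<pi> \<in> transport_plans \<mu> \<nu>" using \<pi> by (simp add: optimal_plan_def)
  interpret \<pi>: prob_space \<pi> using transport_plansD(1)[OF t\<pi>] .
  note \<pi>_sets = transport_plansD(2)[OF t\<pi>]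
  have \<pi>_space: "space \<pi> = UNIV" using space_transport_plan[OF t\<pi>] sp by simp
  have I_sets: "C \<in> sets \<mu>" if "C \<in> ?I" for C
    using closed_components[OF closed_support that] \<mu> by simp
  have J_sets: "D \<in> sets \<nu>" if "D \<in> ?J" for D
    using closed_components[OF closed_support that] \<nu> by simp
  \<comment> \<open>Being finite in number, the components are relatively open in the support; each
    therefore has positive mass and \<open>kantorovich_potential_piece\<close> applies to
    it.\<close>
  have I_pos: "emeasure \<mu> C \<noteq> 0" if "C \<in> ?I" for C
    using that in_components_nonempty
    by (intro emeasure_openin_support[OF \<mu> assms(1)] openin_component_finite[OF assms(8)]) auto
  show ?thesis
    unfolding unique_kantorovich_potentials_def
  proof (intro ballI)
    fix f1 f2
    assume f1: "f1 \<in> kantorovich_potentials c \<mu> \<nu>" and f2: "f2 \<in> kantorovich_potentials c \<mu> \<nu>"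
    note slack1 = kantorovich_potential_slack[OF \<mu> \<nu> assms(5-7) f1 \<pi>]
    note slack2 = kantorovich_potential_slack[OF \<mu> \<nu> assms(5-7) f2 \<pi>]
    have "\<exists>a::real. AE x in \<mu>. x \<in> C \<longrightarrow> f1 x - f2 x = ereal a" if C: "C \<in> ?I" for C
    proof -
      note piece = kantorovich_potential_piece[OF assms(1) \<mu> \<nu> assms(5-7) _ \<pi> I_sets[OF C] I_pos[OF C]]
      obtain a :: real where "AE x in source_piece \<mu> C. f1 x - f2 x = ereal a"
        using uniq[OF C] piece[OF f1] piece[OF f2]
        unfolding unique_kantorovich_potentials_def by blast
      from AE_source_pieceD[OF this I_sets[OF C]] show ?thesis by auto
    qed
    then obtain a :: "'a set \<Rightarrow> real"
      where a: "\<And>C. C \<in> ?I \<Longrightarrow> AE x in \<mu>. x \<in> C \<longrightarrow> f1 x - f2 x = ereal (a C)"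
      by metis
    have a_all: "AE x in \<mu>. \<forall>C\<in>?I. x \<in> C \<longrightarrow> f1 x - f2 x = ereal (a C)"
      using assms(8) a by (intro AE_finite_allI) auto
    \<comment> \<open>\<open>real_of_ereal\<close> sends infinite values to 0. On
      \<open>support \<nu>\<close> both transforms are finite, so there \<open>h\<close> is the true
      difference and inherits continuity.\<close>
    define h where "h y = real_of_ereal (ctransform_X UNIV c f2 y) - real_of_ereal (ctransform_X UNIV c f1 y)" for y
    have hm [measurable]: "h \<in> borel_measurable \<nu>"
    proof -
      have [measurable]: "ctransform_X UNIV c f \<in> borel_measurable \<nu>" for f
        using borel_measurable_ctransform_X[OF assms(5)] measurable_cong_sets[OF \<nu> refl] by auto
      show ?thesis unfolding h_def by measurable
    qed
    have h_cont: "continuous_on (support \<nu>) h"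
    proof -
      have "continuous_on (support \<nu>) (\<lambda>y. real_of_ereal (ctransform_X UNIV c f y))"
        if "f \<in> kantorovich_potentials c \<mu> \<nu>" for f
        using assms(10)[OF that] continuous_on_iff_real[of "support \<nu>" "ctransform_X UNIV c f"]
        by (simp add: o_def)
      then show ?thesis unfolding h_def using f1 f2 by (intro continuous_intros)
    qed
    \<comment> \<open>Where both slackness equalities hold, all four terms are finite. Subtracting
      the equalities cancels \<open>c (x, y)\<close> and identifies \<open>h y\<close> with
      \<open>f1 x - f2 x\<close>, which is \<open>a C\<close> for \<open>x\<close> in
      \<open>C\<close>.\<close>
    have key: "AE z in \<pi>. fst z \<in> support \<mu> \<and> snd z \<in> support \<nu> \<and> (\<forall>C\<in>?I. fst z \<in> C \<longrightarrow> h (snd z) = a C)"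
      using slack1(3) slack2(3) AE_transport_plan_fst[OF t\<pi> a_all]
        AE_transport_plan_fst[OF t\<pi> AE_support[OF \<mu> assms(1)]]
        AE_transport_plan_snd[OF t\<pi> AE_support[OF \<nu> assms(3)]]
    proof eventually_elim
      case (elim z)
      have "h (snd z) = a C" if "C \<in> ?I" "fst z \<in> C" for C
      proof -
        have d: "f1 (fst z) - f2 (fst z) = ereal (a C)" using elim(3) that by blast
        show ?thesis
          using elim(1,2) ereal_add_eq_ereal[OF elim(1)] ereal_add_eq_ereal[OF elim(2)] d
          unfolding h_def
          by (cases "f1 (fst z)"; cases "f2 (fst z)"; cases "ctransform_X UNIV c f1 (snd z)";
              cases "ctransform_X UNIV c f2 (snd z)") auto
      qed
      then show ?case using elim(4,5) by blast
    qed
    have h_AE: "AE y in \<nu>. h y \<in> a ` ?I"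
    proof -
      have [measurable]: "a ` ?I \<in> sets borel"
        using assms(8) by (intro borel_closed finite_imp_closed) simp
      have "AE z in \<pi>. h (snd z) \<in> a ` ?I"
        using key
      proof eventually_elim
        case (elim z)
        then obtain C where "C \<in> ?I" "fst z \<in> C" using Union_components[of "support \<mu>"] by blast
        then show ?case using elim by blast
      qed
      then have "AE y in distr \<pi> \<nu> snd. h y \<in> a ` ?I"
        by (subst AE_distr_iff) (auto simp: measurable_cong_sets[OF \<pi>_sets refl])
      then show ?thesis by (simp only: transport_plansD(4)[OF t\<pi>])
    qed
    \<comment> \<open>A finite set is closed, so the points of the support at which \<open>h\<close>
      misses it form a relatively open set. If nonempty, it would have positive mass, against
      \<open>h_AE\<close>.\<close>
    have h_supp: "h y \<in> a ` ?I" if y: "y \<in> support \<nu>" for y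
    proof (rule ccontr)
      assume n: "h y \<notin> a ` ?I"
      have "open (- a ` ?I)" using assms(8) by (intro open_Compl finite_imp_closed) simp
      then have "openin (top_of_set (support \<nu>)) (support \<nu> \<inter> h -` (- a ` ?I))"
        using h_cont continuous_openin_preimage_gen by blast
      then have "emeasure \<nu> (support \<nu> \<inter> h -` (- a ` ?I)) \<noteq> 0"
        by (rule emeasure_openin_support[OF \<nu> assms(3)]) (use y n in blast)
      moreover have "emeasure \<nu> (support \<nu> \<inter> h -` (- a ` ?I)) = 0"
      \<comment> \<open>\<open>emeasure\<close> is 0 on non-measurable sets, which settles the
        second case.\<close>
      proof (cases "support \<nu> \<inter> h -` (- a ` ?I) \<in> sets \<nu>")
        case True
        then show ?thesis
          using h_AE by (subst AE_iff_null_sets[THEN iffD2, THEN null_setsD1]) (auto elim: eventually_mono)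
      qed (simp add: emeasure_notin_sets)
      ultimately show False by simp
    qed
    have "\<exists>b. \<forall>y\<in>D. h y = b" if D: "D \<in> ?J" for D
    proof -
      have DS: "D \<subseteq> support \<nu>" using in_components_subset[OF D] .
      \<comment> \<open>A finite connected set of reals has at most one point.\<close>
      have "connected (h ` D)"
        using in_components_connected[OF D] continuous_on_subset[OF h_cont DS]
        by (rule connected_continuous_image[rotated])
      moreover have "finite (h ` D)"
        by (rule finite_subset[of _ "a ` ?I"]) (use h_supp DS assms(8) in auto)
      ultimately obtain b where "h ` D \<subseteq> {b}" by (auto simp: connected_finite_iff_sing)
      then show ?thesis by blast
    qed
    then obtain b where b: "\<And>D y. D \<in> ?J \<Longrightarrow> y \<in> D \<Longrightarrow> h y = b D" by metis
    have "support \<mu> \<noteq> {}"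
      using AE_support[OF \<mu> assms(1)] \<mu>.AE_False by auto
    then obtain C0 where C0: "C0 \<in> ?I" using Union_components[of "support \<mu>"] by blast
    \<comment> \<open>\<open>a C0\<close> serves as reference value; \<open>\<A>\<close> and
      \<open>\<B>\<close> collect the source and target components whose constant equals it.\<close>
    define \<A> where "\<A> = {C\<in>?I. a C = a C0}"
    define \<B> where "\<B> = {D\<in>?J. b D = a C0}"
    have \<A>: "\<Union>\<A> \<in> sets \<mu>" using assms(8) I_sets by (intro sets.finite_Union) (auto simp: \<A>_def)
    have \<B>: "\<Union>\<B> \<in> sets \<nu>" using assms(9) J_sets by (intro sets.finite_Union) (auto simp: \<B>_def)
    have same: "emeasure \<mu> (\<Union>\<A>) = emeasure \<nu> (\<Union>\<B>)"
    proof -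
      have [measurable]: "fst \<in> \<pi> \<rightarrow>\<^sub>M \<mu>" "snd \<in> \<pi> \<rightarrow>\<^sub>M \<nu>"
        by (auto simp: measurable_cong_sets[OF \<pi>_sets refl])
      have "emeasure \<mu> (\<Union>\<A>) = emeasure (distr \<pi> \<mu> fst) (\<Union>\<A>)" using transport_plansD(3)[OF t\<pi>] by simp
      also have "\<dots> = emeasure \<pi> (fst -` \<Union>\<A> \<inter> space \<pi>)" using \<A> by (intro emeasure_distr) auto
      \<comment> \<open>Up to a \<open>\<pi>\<close>-null set, both preimages are the event
        \<open>h (snd z) = a C0\<close>.\<close>
      also have "\<dots> = emeasure \<pi> (snd -` \<Union>\<B> \<inter> space \<pi>)"
      proof (rule emeasure_eq_AE)
        show "AE z in \<pi>. (z \<in> fst -` \<Union>\<A> \<inter> space \<pi>) = (z \<in> snd -` \<Union>\<B> \<inter> space \<pi>)"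
          using key
        proof eventually_elim
          case (elim z)
          obtain C where C: "C \<in> ?I" "fst z \<in> C" using elim Union_components[of "support \<mu>"] by blast
          obtain D where D: "D \<in> ?J" "snd z \<in> D" using elim Union_components[of "support \<nu>"] by blast
          have "fst z \<in> \<Union>\<A> \<longleftrightarrow> h (snd z) = a C0"
          proof
            assume "fst z \<in> \<Union>\<A>"
            then obtain C' where C': "C' \<in> ?I" "a C' = a C0" "fst z \<in> C'"
              unfolding \<A>_def by blast
            then have "h (snd z) = a C'" using elim by blast
            then show "h (snd z) = a C0" using C'(2) by (rule trans)
          next
            assume "h (snd z) = a C0"
            moreover have "h (snd z) = a C" using elim C by blast
            ultimately have "C \<in> \<A>" using C(1) unfolding \<A>_def by simp
            then show "fst z \<in> \<Union>\<A>" using C(2) by blast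
          qed
          moreover have "snd z \<in> \<Union>\<B> \<longleftrightarrow> h (snd z) = a C0"
          proof
            assume "snd z \<in> \<Union>\<B>"
            then obtain D' where D': "D' \<in> ?J" "b D' = a C0" "snd z \<in> D'"
              unfolding \<B>_def by blast
            show "h (snd z) = a C0" using b[OF D'(1,3)] D'(2) by (rule trans)
          next
            assume "h (snd z) = a C0"
            then have "D \<in> \<B>" using b[OF D] D(1) unfolding \<B>_def by simp
            then show "snd z \<in> \<Union>\<B>" using D(2) by blast
          qed
          ultimately show ?case by (auto simp: \<pi>_space)
        qed
      qed (use \<A> \<B> in measurable)
      also have "\<dots> = emeasure (distr \<pi> \<nu> snd) (\<Union>\<B>)" using \<B> by (intro emeasure_distr[symmetric]) auto
      also have "\<dots> = emeasure \<nu> (\<Union>\<B>)" using transport_plansD(4)[OF t\<pi>] by simp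
      finally show ?thesis .
    qed
    \<comment> \<open>A second value would make \<open>\<A>\<close> and \<open>\<B>\<close> nonempty
      proper families of equal mass, against nondegeneracy.\<close>
    have "\<A> = ?I"
    proof (rule ccontr)
      assume ne: "\<A> \<noteq> ?I"
      then obtain C1 where C1: "C1 \<in> ?I" "C1 \<notin> \<A>" by (auto simp: \<A>_def)
      have "\<A> \<noteq> {}" "\<A> \<subset> ?I" using C0 ne by (auto simp: \<A>_def)
      \<comment> \<open>An empty \<open>\<B>\<close> would leave \<open>\<A>\<close> without mass,
        although it contains \<open>C0\<close>.\<close>
      moreover have "\<B> \<noteq> {}"
      proof
        assume "\<B> = {}"
        then have "emeasure \<mu> (\<Union>\<A>) = 0" using same by simp
        moreover have "emeasure \<mu> C0 \<le> emeasure \<mu> (\<Union>\<A>)"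
          using C0 \<A> by (intro emeasure_mono) (auto simp: \<A>_def)
        ultimately show False using I_pos[OF C0] by simp
      qed
      \<comment> \<open>If \<open>\<B>\<close> were all of \<open>?J\<close>, \<open>\<A>\<close>
        would have full mass and the omitted component \<open>C1\<close> would be null.\<close>
      moreover have "\<B> \<subset> ?J"
      proof -
        have "\<B> \<noteq> ?J"
        proof
          assume "\<B> = ?J"
          then have "emeasure \<mu> (\<Union>\<A>) = 1"
            using same support_full[OF \<nu> \<nu>.finite_measure_axioms] \<nu>.emeasure_space_1
            by (simp add: Union_components)
          then have "AE x in \<mu>. x \<in> \<Union>\<A>" using \<mu>.AE_in_set_eq_1[OF \<A>] by (simp add: measure_def)
          then have "C1 \<in> null_sets \<mu>"
            unfolding AE_iff_null_sets[OF I_sets[OF C1(1)]]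
          proof eventually_elim
            case (elim x)
            then obtain C where "C \<in> \<A>" "x \<in> C" by blast
            then show ?case using C1 components_nonoverlap[of C "support \<mu>" C1] by (auto simp: \<A>_def)
          qed
          then show False using I_pos[OF C1(1)] by auto
        qed
        then show ?thesis by (auto simp: \<B>_def)
      qed
      ultimately show False using assms(11) same unfolding nondegenerate_def by blast
    qed
    have "AE x in \<mu>. f1 x - f2 x = ereal (a C0)"
      using a_all AE_support[OF \<mu> assms(1)]
    proof eventually_elim
      case (elim x)
      then obtain C where C: "C \<in> ?I" "x \<in> C" using Union_components[of "support \<mu>"] by blast
      then have "a C = a C0" using \<open>\<A> = ?I\<close> by (auto simp: \<A>_def)
      then show ?case using elim C by auto
    qed
    then show "\<exists>a::real. AE x in \<mu>. f1 x - f2 x = ereal a" ..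
  qed
qed

end
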